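(* The integrality gap of $\mathrm{SER}$ and of $\mathrm{SER}^+$ for $(1,2)$-ATSP is at least $6/5$; that is, there is an instance $G$ of $(1,2)$-ATSP with $\mathrm{Opt}(G)/\mathrm{Opt}_{\mathrm{SER}}(G)\ge 6/5$ and $\mathrm{Opt}(G)/\mathrm{Opt}_{\mathrm{SER}^+}(G)\ge 6/5$.
   Context: An instance $G$ of $(1,2)$-ATSP is a complete directed graph without loops on a finite vertex set, with arc costs in $\{1,2\}$; $\mathrm{Opt}(G)$ is the minimum cost of a directed Hamiltonian cycle. For $S\subseteq V(G)$, $\delta^+(S)$ and $\delta^-(S)$ are the sets of arcs leaving and entering $S$, $x(F)=\sum_{e\in F}x_e$. $\mathrm{SER}(G)$ is the polytope of $x\in\mathbb{R}^{E(G)}$ with $x(\delta^-(v))=x(\delta^+(v))=1$ for all $v$, $x(\delta^-(S))\ge1$, $x(\delta^+(S))\ge1$ for all $\emptyset\ne S\subsetneq V(G)$, $x\ge0$; $\mathrm{Opt}_{\mathrm{SER}}(G)$ is the minimum of $\sum_e\mathrm{cost}(e)x_e$ over it. $\mathrm{SER}^+(G)$ adds the constraint $\sum_e\mathrm{cost}(e)x_e\ge\lceil\mathrm{Opt}_{\mathrm{SER}}(G)\rceil$, with optimal value $\mathrm{Opt}_{\mathrm{SER}^+}(G)$. The integrality gap of a relaxation is the supremum over instances of $\mathrm{Opt}(G)$ divided by the optimal value of the relaxation. *)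

theory Defs
  imports
    "HOL-Library.Extended_Real"
    "HOL-Library.FuncSet"
    "Graph_Theory.Graph_Theory"
    "Graph_Theory.Weighted_Graph"
begin

text \<open>
  An instance is a complete loopless digraph together with its arc costs. At least two vertices
  are required: otherwise there is neither a Hamiltonian cycle nor a feasible point of the
  relaxations below.
\<close>

definition atsp12 :: "'a pair_pre_digraph \<Rightarrow> ('a \<times> 'a) weight_fun \<Rightarrow> bool" where
  "atsp12 G c \<longleftrightarrow>
     2 \<le> card (pverts G) \<and> complete_digraph (card (pverts G)) (with_proj G) \<and>
     (\<forall>e \<in> parcs G. c e \<in> {1, 2})"

definition hamiltonian_cycle :: "'a pair_pre_digraph \<Rightarrow> ('a \<times> 'a) awalk \<Rightarrow> bool" where
  "hamiltonian_cycle G p \<longleftrightarrow> pre_digraph.cycle (with_proj G) p \<and> fst ` set p = pverts G"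

definition opt :: "'a pair_pre_digraph \<Rightarrow> ('a \<times> 'a) weight_fun \<Rightarrow> real" where
  "opt G c = Min (wf_digraph.awalk_cost c ` {p. hamiltonian_cycle G p})"

definition out_cut :: "'a pair_pre_digraph \<Rightarrow> 'a set \<Rightarrow> ('a \<times> 'a) set" where
  "out_cut G S = {e \<in> parcs G. fst e \<in> S \<and> snd e \<notin> S}"

definition in_cut :: "'a pair_pre_digraph \<Rightarrow> 'a set \<Rightarrow> ('a \<times> 'a) set" where
  "in_cut G S = {e \<in> parcs G. fst e \<notin> S \<and> snd e \<in> S}"

text \<open>
  A vector indexed by the arcs of \<open>G\<close> is a function that is extensional on \<open>parcs G\<close>, that is, it
  has the fixed value \<open>undefined\<close> elsewhere.
\<close>

definition SER :: "'a pair_pre_digraph \<Rightarrow> ('a \<times> 'a \<Rightarrow> real) set" where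
  "SER G = {x \<in> extensional (parcs G).
     (\<forall>v \<in> pverts G. sum x (in_cut G {v}) = 1 \<and> sum x (out_cut G {v}) = 1) \<and>
     (\<forall>S. S \<noteq> {} \<and> S \<subset> pverts G \<longrightarrow> sum x (in_cut G S) \<ge> 1 \<and> sum x (out_cut G S) \<ge> 1) \<and>
     (\<forall>e \<in> parcs G. x e \<ge> 0)}"

definition frac_cost ::
    "'a pair_pre_digraph \<Rightarrow> ('a \<times> 'a) weight_fun \<Rightarrow> ('a \<times> 'a \<Rightarrow> real) \<Rightarrow> real" where
  "frac_cost G c x = (\<Sum>e \<in> parcs G. c e * x e)"

text \<open>
  For an instance, the infima below are minima: the polytopes are compact, and both contain the
  incidence vector of an optimal Hamiltonian cycle, whose cost is an integer.
\<close>

definition opt_SER :: "'a pair_pre_digraph \<Rightarrow> ('a \<times> 'a) weight_fun \<Rightarrow> real" where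
  "opt_SER G c = (INF x \<in> SER G. frac_cost G c x)"

definition SER_plus ::
    "'a pair_pre_digraph \<Rightarrow> ('a \<times> 'a) weight_fun \<Rightarrow> ('a \<times> 'a \<Rightarrow> real) set" where
  "SER_plus G c = {x \<in> SER G. frac_cost G c x \<ge> of_int \<lceil>opt_SER G c\<rceil>}"

definition opt_SER_plus :: "'a pair_pre_digraph \<Rightarrow> ('a \<times> 'a) weight_fun \<Rightarrow> real" where
  "opt_SER_plus G c = (INF x \<in> SER_plus G c. frac_cost G c x)"

text \<open>
  The argument is the optimal value of a relaxation as a function of the instance. As instances are
  finite, taking the vertices to be natural numbers covers all of them up to isomorphism.
\<close>

definition integrality_gap ::
    "(nat pair_pre_digraph \<Rightarrow> (nat \<times> nat) weight_fun \<Rightarrow> real) \<Rightarrow> ereal" where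
  "integrality_gap rel_opt =
     (SUP (G, c) \<in> {(G, c). atsp12 G c}. ereal (opt G c / rel_opt G c))"

end

theory Submission
  imports Defs
begin

text \<open>
  On five vertices, let ten arcs have cost 1 and form a 2-in, 2-out-regular digraph that is
  2-arc-connected but not Hamiltonian. Giving each of them weight 1/2 yields a feasible point of
  cost 5. Every feasible point costs at least the number of vertices, so both relaxations have
  optimum exactly 5, whereas every Hamiltonian cycle uses an arc of cost 2: in a cycle cover by
  arcs of cost 1, the arc leaving vertex 0 forces the reverse arc as well.
\<close>

section \<open>Hamiltonian cycles as arc lists\<close>

lemma finite_parcs_atsp12:
  assumes "atsp12 G c"
  shows "finite (pverts G)" "finite (parcs G)" "parcs G \<subseteq> pverts G \<times> pverts G"
proof -
  show V: "finite (pverts G)" and P: "parcs G \<subseteq> pverts G \<times> pverts G"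
    using assms by (auto simp: atsp12_def complete_digraph_pair_def)
  show "finite (parcs G)"
    using V by (intro finite_subset[OF P] finite_cartesian_product)
qed

lemma pawalk_verts_eq_Cons_map_snd: "pcas u p v \<Longrightarrow> pawalk_verts u p = u # map snd p"
  by (induction p arbitrary: u) auto

text \<open>\<open>cycle\<close> demands distinctness of the vertex list without its first entry;
  for a walk that remainder is the list of arc heads.\<close>

lemma hamiltonian_cycleE:
  assumes "hamiltonian_cycle G p"
  obtains u where "set p \<subseteq> parcs G" "pcas u p u" "distinct (map snd p)" "fst ` set p = pverts G"
  using assms
  by (auto simp: hamiltonian_cycle_def pre_digraph.cycle_def pre_digraph.awalk_def
      cas_with_proj_eq awalk_verts_with_proj_eq pawalk_verts_eq_Cons_map_snd)

text \<open>Distinct heads bound the length from above, tails covering all vertices bound it from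
  below.\<close>

lemma length_hamiltonian_cycle:
  assumes "atsp12 G c" "hamiltonian_cycle G p"
  shows "length p = card (pverts G)"
proof (rule antisym)
  from assms(2) obtain u where p: "set p \<subseteq> parcs G" "distinct (map snd p)" "fst ` set p = pverts G"
    by (rule hamiltonian_cycleE)
  have "length p = card (snd ` set p)"
    using distinct_card[OF p(2)] by simp
  also have "\<dots> \<le> card (pverts G)"
    using p(1) finite_parcs_atsp12[OF assms(1)] by (intro card_mono) auto
  finally show "length p \<le> card (pverts G)" .
  show "card (pverts G) \<le> length p"
    using card_length[of "map fst p"] p(3) by simp
qed

lemma finite_hamiltonian_cycles:
  assumes "atsp12 G c"
  shows "finite {p. hamiltonian_cycle G p}"
proof (rule finite_subset)
  show "{p. hamiltonian_cycle G p} \<subseteq> {p. set p \<subseteq> parcs G \<and> length p = card (pverts G)}"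
    using length_hamiltonian_cycle[OF assms] by (blast elim: hamiltonian_cycleE)
  show "finite {p. set p \<subseteq> parcs G \<and> length p = card (pverts G)}"
    by (rule finite_lists_length_eq[OF finite_parcs_atsp12(2)[OF assms]])
qed

lemma awalk_cost_eq_sum_list: "wf_digraph.awalk_cost c p = sum_list (map c p)"
proof -
  \<comment> \<open>The defining equation of \<open>awalk_cost\<close> carries the locale premise,
    although the cost does not depend on the digraph. Any well-formed digraph with the right arc
    type discharges it.\<close>
  have "wf_digraph \<lparr>verts = UNIV :: unit set, arcs = UNIV, tail = \<lambda>_. (), head = \<lambda>_. ()\<rparr>"
    by (simp add: wf_digraph_def)
  then show ?thesis
    by (rule wf_digraph.awalk_cost_def)
qed

section \<open>Lower bound on both relaxations\<close>

lemma sum_parcs_SER: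
  assumes "atsp12 G c" "x \<in> SER G"
  shows "sum x (parcs G) = card (pverts G)"
proof -
  note fin = finite_parcs_atsp12[OF assms(1)]
  \<comment> \<open>Grouping arcs by head gives one in-degree constraint per vertex: without loops,
    the arcs with head \<open>v\<close> are exactly those entering \<open>{v}\<close>.\<close>
  have loopfree: "fst e \<noteq> snd e" if "e \<in> parcs G" for e
    using that assms(1) by (auto simp: atsp12_def complete_digraph_pair_def)
  have "sum x (parcs G) = (\<Sum>v\<in>pverts G. sum x {e \<in> parcs G. snd e = v})"
    using fin by (intro sum.group[symmetric]) auto
  also have "\<dots> = (\<Sum>v\<in>pverts G. sum x (in_cut G {v}))"
    using loopfree by (intro sum.cong arg_cong[where f = "sum x"]) (auto simp: in_cut_def)
  also have "\<dots> = (\<Sum>v\<in>pverts G. 1)"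
    using assms(2) by (intro sum.cong) (auto simp: SER_def)
  finally show ?thesis by simp
qed

lemma card_pverts_le_frac_cost:
  assumes "atsp12 G c" "x \<in> SER G"
  shows "card (pverts G) \<le> frac_cost G c x"
proof -
  have "sum x (parcs G) \<le> frac_cost G c x"
    unfolding frac_cost_def
  proof (rule sum_mono)
    fix e assume "e \<in> parcs G"
    then have "x e \<ge> 0" "c e \<in> {1, 2}"
      using assms by (auto simp: SER_def atsp12_def)
    then show "x e \<le> c e * x e" by auto
  qed
  then show ?thesis
    by (simp add: sum_parcs_SER[OF assms])
qed

lemma opt_relaxations_eq_card_pverts:
  assumes "atsp12 G c" "x \<in> SER G" "frac_cost G c x = card (pverts G)"
  shows "opt_SER G c = card (pverts G)" "opt_SER_plus G c = card (pverts G)"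
proof -
  \<comment> \<open>Stated for any \<open>P\<close> so that it serves both polytopes. Once
    \<open>opt_SER\<close> is known to be an integer, the ceiling leaves it unchanged and
    \<open>x\<close> stays feasible for \<open>SER_plus\<close>.\<close>
  have INF_eq: "(INF y \<in> P. frac_cost G c y) = card (pverts G)" if "x \<in> P" "P \<subseteq> SER G" for P
    using that assms card_pverts_le_frac_cost[OF assms(1)]
    by (intro cInf_eq_minimum) (auto simp: image_iff intro!: bexI[of _ x])
  show opt: "opt_SER G c = card (pverts G)"
    using assms(2) by (auto simp: opt_SER_def intro: INF_eq)
  show "opt_SER_plus G c = card (pverts G)"
    unfolding opt_SER_plus_def
    using assms(2,3) by (intro INF_eq) (auto simp: SER_plus_def opt)
qed

section \<open>The five-vertex instance and its half-integral point\<close>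

definition K5 :: "nat pair_pre_digraph" where
  "K5 = (let V = {0, 1, 2, 3, 4} in \<lparr>pverts = V, parcs = {(u, v). (u, v) \<in> V \<times> V \<and> u \<noteq> v}\<rparr>)"

lemma pverts_K5: "pverts K5 = {0, 1, 2, 3, 4}"
  by (simp add: K5_def Let_def)

lemma parcs_K5: "parcs K5 = {(u, v). (u, v) \<in> pverts K5 \<times> pverts K5 \<and> u \<noteq> v}"
  by (simp only: K5_def Let_def pair_pre_digraph.simps)

text \<open>The directed 4-cycle 1, 3, 2, 4 together with both orientations of the edges 01, 02 and
  34. Exchanging 1 with 2 and 3 with 4 is an automorphism.\<close>

definition unit_arcs :: "(nat \<times> nat) set" where
  "unit_arcs =
     {(0, 1), (0, 2), (1, 0), (1, 3), (2, 0), (2, 4), (3, 2), (3, 4), (4, 1), (4, 3)}"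

definition K5_cost :: "(nat \<times> nat) weight_fun" where
  "K5_cost e = (if e \<in> unit_arcs then 1 else 2)"

definition half_point :: "nat \<times> nat \<Rightarrow> real" where
  "half_point = restrict (\<lambda>e. if e \<in> unit_arcs then 1 / 2 else 0) (parcs K5)"

lemma atsp12_K5: "atsp12 K5 K5_cost"
  unfolding atsp12_def complete_digraph_pair_def
  using parcs_K5 by (simp add: pverts_K5 K5_cost_def)

lemma unit_arcs_subset: "unit_arcs \<subseteq> parcs K5"
  by (simp add: unit_arcs_def parcs_K5 pverts_K5)

text \<open>Reduces sums over all arcs to the ten explicit ones, which can be expanded. Constant
  \<open>f\<close> yields cut values, \<open>f = K5_cost\<close> with trivial \<open>P\<close> the
  total cost.\<close>

lemma sum_half_point:
  "(\<Sum>e \<in> {e \<in> parcs K5. P e}. f e * half_point e) = (\<Sum>e\<in>unit_arcs. if P e then f e / 2 else 0)"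
proof -
  have "(\<Sum>e \<in> {e \<in> parcs K5. P e}. f e * half_point e) =
      (\<Sum>e\<in>parcs K5. if e \<in> unit_arcs then (if P e then f e / 2 else 0) else 0)"
    using finite_parcs_atsp12(2)[OF atsp12_K5]
    by (subst sum.inter_filter) (auto simp: half_point_def intro!: sum.cong)
  also have "\<dots> = (\<Sum>e\<in>unit_arcs. if P e then f e / 2 else 0)"
    using finite_parcs_atsp12(2)[OF atsp12_K5] unit_arcs_subset
    by (simp add: sum.inter_restrict[symmetric] Int_absorb1)
  finally show ?thesis .
qed

lemma sum_half_point_cut:
  "sum half_point (in_cut K5 S) = (\<Sum>(u, v)\<in>unit_arcs. if u \<notin> S \<and> v \<in> S then 1 / 2 else 0)"
  "sum half_point (out_cut K5 S) = (\<Sum>(u, v)\<in>unit_arcs. if u \<in> S \<and> v \<notin> S then 1 / 2 else 0)"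
  using sum_half_point[of "\<lambda>_. 1"] by (simp_all add: in_cut_def out_cut_def case_prod_beta)

lemma half_point_in_SER: "half_point \<in> SER K5"
proof -
  have ext: "half_point \<in> extensional (parcs K5)"
    by (simp add: half_point_def)
  have nonneg: "\<forall>e\<in>parcs K5. half_point e \<ge> 0"
    by (simp add: half_point_def)
  have degree: "\<forall>v\<in>pverts K5. sum half_point (in_cut K5 {v}) = 1 \<and> sum half_point (out_cut K5 {v}) = 1"
    unfolding sum_half_point_cut by (simp add: pverts_K5 unit_arcs_def)
  have cut: "sum half_point (in_cut K5 S) \<ge> 1 \<and> sum half_point (out_cut K5 S) \<ge> 1"
    if "S \<noteq> {}" "S \<subset> pverts K5" for S
  proof -
    \<comment> \<open>A cut value depends only on which of the five vertices lie in
      \<open>S\<close>. These two facts rule out the extreme cases among the 32 checked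
      below.\<close>
    have "S \<inter> {0, 1, 2, 3, 4} \<noteq> {}" "\<not> {0, 1, 2, 3, 4} \<subseteq> S"
      using that by (auto simp: pverts_K5)
    then show ?thesis
      unfolding sum_half_point_cut unit_arcs_def
      by (cases "0 \<in> S"; cases "1 \<in> S"; cases "2 \<in> S"; cases "3 \<in> S"; cases "4 \<in> S") simp_all
  qed
  show ?thesis
    unfolding SER_def using ext nonneg degree cut by blast
qed

lemma frac_cost_half_point: "frac_cost K5 K5_cost half_point = 5"
  using sum_half_point[of K5_cost "\<lambda>_. True"]
  by (simp add: frac_cost_def K5_cost_def unit_arcs_def)

section \<open>Lower bound on the integral optimum\<close>

lemma unit_arcs_not_hamiltonian:
  assumes "hamiltonian_cycle K5 p"
  shows "\<not> set p \<subseteq> unit_arcs"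
proof
  assume unit: "set p \<subseteq> unit_arcs"
  from assms obtain u where p: "pcas u p u" "fst ` set p = pverts K5"
    by (rule hamiltonian_cycleE)
  have "length p = 5"
    using length_hamiltonian_cycle[OF atsp12_K5 assms] by (simp add: pverts_K5)
  then obtain e\<^sub>1 e\<^sub>2 e\<^sub>3 e\<^sub>4 e\<^sub>5 where "p = [e\<^sub>1, e\<^sub>2, e\<^sub>3, e\<^sub>4, e\<^sub>5]"
    by (auto simp: numeral_eq_Suc length_Suc_conv)
  then obtain v\<^sub>1 v\<^sub>2 v\<^sub>3 v\<^sub>4
    where q: "p = [(u, v\<^sub>1), (v\<^sub>1, v\<^sub>2), (v\<^sub>2, v\<^sub>3), (v\<^sub>3, v\<^sub>4), (v\<^sub>4, u)]"
    using p(1) by (cases e\<^sub>1; cases e\<^sub>2; cases e\<^sub>3; cases e\<^sub>4; cases e\<^sub>5) auto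
  \<comment> \<open>Five tails cover five vertices, so none repeats. Hence heads determine arcs, and
    a 5-cycle contains no arc together with its reverse.\<close>
  have "card (set [u, v\<^sub>1, v\<^sub>2, v\<^sub>3, v\<^sub>4]) = length [u, v\<^sub>1, v\<^sub>2, v\<^sub>3, v\<^sub>4]"
    using p(2) by (simp add: q pverts_K5)
  then have distinct: "distinct [u, v\<^sub>1, v\<^sub>2, v\<^sub>3, v\<^sub>4]"
    by (rule card_distinct)
  have head_inj: "a = a'" if "(a, b) \<in> set p" "(a', b) \<in> set p" for a a' b
    using that distinct by (auto simp: q)
  have no_2_cycle: "(b, a) \<notin> set p" if "(a, b) \<in> set p" for a b
    using that distinct by (auto simp: q)
  have tail: "\<exists>b. (a, b) \<in> set p \<and> (a, b) \<in> unit_arcs" if "a \<in> pverts K5" for a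
    using that p(2) unit by force
  have "(0, 1) \<in> set p \<or> (0, 2) \<in> set p"
    using tail[of 0] by (auto simp: pverts_K5 unit_arcs_def)
  then show False
  proof
    \<comment> \<open>Head 1 is taken, so 4 must be left towards 3; then head 3 is taken, so 1 must
      be left towards 0, closing a 2-cycle.\<close>
    assume 01: "(0, 1) \<in> set p"
    then have "(4, 3) \<in> set p"
      using tail[of 4] head_inj[of 0 1 4] by (auto simp: pverts_K5 unit_arcs_def)
    then have "(1, 0) \<in> set p"
      using tail[of 1] head_inj[of 4 3 1] by (auto simp: pverts_K5 unit_arcs_def)
    with 01 show False
      using no_2_cycle by blast
  next
    \<comment> \<open>The mirror image of the first case under the automorphism.\<close>
    assume 02: "(0, 2) \<in> set p"
    then have "(3, 4) \<in> set p"
      using tail[of 3] head_inj[of 0 2 3] by (auto simp: pverts_K5 unit_arcs_def)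
    then have "(2, 0) \<in> set p"
      using tail[of 2] head_inj[of 3 4 2] by (auto simp: pverts_K5 unit_arcs_def)
    with 02 show False
      using no_2_cycle by blast
  qed
qed

lemma opt_K5_ge: "opt K5 K5_cost \<ge> 6"
proof -
  let ?H = "{p. hamiltonian_cycle K5 p}"
  have ge: "wf_digraph.awalk_cost K5_cost p \<ge> 6" if p: "hamiltonian_cycle K5 p" for p
  proof -
    obtain e where e: "e \<in> set p" "e \<notin> unit_arcs"
      using unit_arcs_not_hamiltonian[OF p] by blast
    obtain xs ys where split: "p = xs @ e # ys"
      using split_list[OF e(1)] by blast
    \<comment> \<open>The four arcs around \<open>e\<close> cost at least 1 each and
      \<open>e\<close> costs 2.\<close>
    have ge_length: "sum_list (map K5_cost zs) \<ge> length zs" for zs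
      by (induction zs) (auto simp: K5_cost_def)
    have "length p = 5"
      using length_hamiltonian_cycle[OF atsp12_K5 p] by (simp add: pverts_K5)
    then show ?thesis
      using ge_length[of xs] ge_length[of ys] e(2)
      by (simp add: awalk_cost_eq_sum_list split K5_cost_def)
  qed
  \<comment> \<open>\<open>Min\<close> is meaningful only on a nonempty finite set, so some
    Hamiltonian cycle must be exhibited, whatever its cost.\<close>
  have "hamiltonian_cycle K5 [(0, 1), (1, 2), (2, 3), (3, 4), (4, 0)]"
    by (auto simp: hamiltonian_cycle_def pre_digraph.cycle_def pre_digraph.awalk_def
        cas_with_proj_eq awalk_verts_with_proj_eq parcs_K5 pverts_K5)
  then have "?H \<noteq> {}" by blast
  then show ?thesis
    using ge finite_hamiltonian_cycles[OF atsp12_K5]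
    by (auto simp: opt_def)
qed

lemma le_integrality_gap:
  assumes "atsp12 G c" "r \<le> opt G c / rel_opt G c"
  shows "ereal r \<le> integrality_gap rel_opt"
  unfolding integrality_gap_def using assms by (auto intro!: SUP_upper2[of "(G, c)"])

theorem theorem1:
  shows "integrality_gap opt_SER \<ge> ereal (6 / 5) \<and>
    integrality_gap opt_SER_plus \<ge> ereal (6 / 5) \<and>
    (\<exists>(G :: nat pair_pre_digraph) (c :: (nat \<times> nat) weight_fun).
       atsp12 G c \<and>
       opt G c / opt_SER G c \<ge> 6 / 5 \<and>
       opt G c / opt_SER_plus G c \<ge> 6 / 5)"
proof -
  have "card (pverts K5) = 5"
    by (simp add: pverts_K5)
  then have "opt_SER K5 K5_cost = 5" "opt_SER_plus K5 K5_cost = 5"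
    using opt_relaxations_eq_card_pverts[OF atsp12_K5 half_point_in_SER] frac_cost_half_point
    by simp_all
  then have "6 / 5 \<le> opt K5 K5_cost / opt_SER K5 K5_cost"
    "6 / 5 \<le> opt K5 K5_cost / opt_SER_plus K5 K5_cost"
    using opt_K5_ge by simp_all
  then show ?thesis
    using atsp12_K5 le_integrality_gap by blast
qed

end
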